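(* There is exactly one kinetic coupling condition (up to equality almost everywhere in $\xi$) $$\Psi\colon L^1_\mu((-\infty,0)_\xi,D)^d\to L^1_\mu((0,\infty)_\xi,D)^d,\qquad g=(g^1,\dots,g^d)\mapsto \Psi[g]=(\Psi^1[g],\dots,\Psi^d[g]),$$ which conserves mass, i.e. for all $g\in L^1_\mu((-\infty,0)_\xi,D)^d$ $$\sum_{k=1}^d A_k\left(\int_0^\infty \xi\,\Psi^k_0[g](\xi)\,\mathrm{d}\xi+\int_{-\infty}^0\xi\, g^k_0(\xi)\,\mathrm{d}\xi\right)=0,$$ and which, for every $g$, minimizes among all mass conserving kinetic coupling conditions the energy functional $$\sum_{k=1}^d A_k\left(\int_0^\infty \xi\, H(\Psi^k[g](\xi),\xi)\,\mathrm{d}\xi+\int_{-\infty}^0\xi\, H(g^k(\xi),\xi)\,\mathrm{d}\xi\right).$$ It is given by $$\Psi^k[g](\xi)=M(\rho_*,0,\xi),\qquad \xi>0,\ k=1,\dots,d,$$ where $\rho_*=\rho_*[g]\ge 0$ is the unique number with $$\sum_{k=1}^d A_k\left(\int_0^\infty \xi\, M_0(\rho_*,0,\xi)\,\mathrm{d}\xi+\int_{-\infty}^0 \xi\, g^k_0(\xi)\,\mathrm{d}\xi\right)=0.$$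
   Context: Let $\kappa>0$, $1<\gamma<3$, $d\in\mathbb N$, and $A_1,\dots,A_d>0$. Let $D=\{(x_0,x_1)\in\mathbb R^2 : x_0>0\text{ or }x_0=x_1=0\}$. Set $$\theta=\tfrac{\gamma-1}{2},\quad \lambda=\tfrac1{\gamma-1}-\tfrac12,\quad a_\gamma=\tfrac{2\sqrt{\gamma\kappa}}{\gamma-1},\quad J_\lambda=\int_{-1}^1(1-z^2)^\lambda\,\mathrm{d}z,\quad c_{\gamma,\kappa}=\frac{a_\gamma^{-2/(\gamma-1)}}{J_\lambda},$$ $$\chi(\rho,\xi)=c_{\gamma,\kappa}\,(a_\gamma^2\rho^{\gamma-1}-\xi^2)_+^\lambda .$$ The (vector-valued) Maxwellian is $$M(\rho,u,\xi)=\big(\chi(\rho,\xi-u),\ ((1-\theta)u+\theta\xi)\,\chi(\rho,\xi-u)\big)\in D,$$ and a subscript $0$ (or $1$) on a $D$-valued function denotes its first (second) component. The kinetic energy is, for $f=(f_0,f_1)\in D\setminus\{0\}$ and $\xi\in\mathbb R$, $$H(f,\xi)=\frac{\theta}{1-\theta}\frac{\xi^2}{2}f_0+\frac{\theta}{2c_{\gamma,\kappa}^{1/\lambda}}\frac{f_0^{1+1/\lambda}}{1+1/\lambda}+\frac1{1-\theta}\,\frac12\,\frac{f_1^2}{f_0}-\frac{\theta}{1-\theta}\,\xi f_1,\qquad H(0,\xi)=0;$$ it is nonnegative. $L^1_\mu(I,D)$ denotes the set of measurable $D$-valued functions on $I\subset\mathbb R$ that are integrable with respect to $\mathrm{d}\mu=|\xi|\,\mathrm{d}\xi$.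 The first sum of integrals in the energy functional takes values in $[0,\infty]$; the second one does not depend on $\Psi$, so minimizing the functional for given $g$ means minimizing $\sum_k A_k\int_0^\infty\xi H(\Psi^k[g](\xi),\xi)\,\mathrm{d}\xi$ over all choices of $\Psi[g]\in L^1_\mu((0,\infty)_\xi,D)^d$ satisfying the mass constraint for that $g$. *)

theory Defs
  imports "HOL-Analysis.Analysis"
begin

definition state_space :: "(real \<times> real) set" where
  "state_space = {x. fst x > 0 \<or> x = (0, 0)}"

definition theta :: "real \<Rightarrow> real" where
  "theta \<gamma> = (\<gamma> - 1) / 2"

definition lam :: "real \<Rightarrow> real" where
  "lam \<gamma> = 1 / (\<gamma> - 1) - 1 / 2"

definition a_const :: "real \<Rightarrow> real \<Rightarrow> real" where
  "a_const \<kappa> \<gamma> = 2 * sqrt (\<gamma> * \<kappa>) / (\<gamma> - 1)"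

definition J_const :: "real \<Rightarrow> real" where
  "J_const l = (LINT z|lebesgue_on {-1..1}. (1 - z\<^sup>2) powr l)"

definition c_const :: "real \<Rightarrow> real \<Rightarrow> real" where
  "c_const \<kappa> \<gamma> = a_const \<kappa> \<gamma> powr (- 2 / (\<gamma> - 1)) / J_const (lam \<gamma>)"

definition chi :: "real \<Rightarrow> real \<Rightarrow> real \<Rightarrow> real \<Rightarrow> real" where
  "chi \<kappa> \<gamma> \<rho> \<xi> =
     c_const \<kappa> \<gamma> * (max 0 ((a_const \<kappa> \<gamma>)\<^sup>2 * \<rho> powr (\<gamma> - 1) - \<xi>\<^sup>2)) powr lam \<gamma>"

definition maxwellian :: "real \<Rightarrow> real \<Rightarrow> real \<Rightarrow> real \<Rightarrow> real \<Rightarrow> real \<times> real" where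
  "maxwellian \<kappa> \<gamma> \<rho> u \<xi> =
     (chi \<kappa> \<gamma> \<rho> (\<xi> - u),
      ((1 - theta \<gamma>) * u + theta \<gamma> * \<xi>) * chi \<kappa> \<gamma> \<rho> (\<xi> - u))"

definition kinetic_energy :: "real \<Rightarrow> real \<Rightarrow> real \<times> real \<Rightarrow> real \<Rightarrow> real" where
  "kinetic_energy \<kappa> \<gamma> f \<xi> =
     (if f = (0, 0) then 0
      else theta \<gamma> / (1 - theta \<gamma>) * (\<xi>\<^sup>2 / 2) * fst f
         + theta \<gamma> / (2 * c_const \<kappa> \<gamma> powr (1 / lam \<gamma>))
             * (fst f powr (1 + 1 / lam \<gamma>) / (1 + 1 / lam \<gamma>))
         + 1 / (1 - theta \<gamma>) * (1 / 2) * ((snd f)\<^sup>2 / fst f)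
         - theta \<gamma> / (1 - theta \<gamma>) * \<xi> * snd f)"

text \<open>Elements of \<open>L1_mu I\<close> are functions, not classes modulo null sets; they are
  \<open>undefined\<close> outside \<open>I\<close>, so that they are determined by their values on \<open>I\<close>.\<close>

definition L1_mu :: "real set \<Rightarrow> (real \<Rightarrow> real \<times> real) set" where
  "L1_mu I = {f \<in> I \<rightarrow>\<^sub>E state_space.
     integrable (density (lebesgue_on I) (\<lambda>\<xi>. ennreal \<bar>\<xi>\<bar>)) f}"

definition incoming :: "('d \<Rightarrow> real \<Rightarrow> real \<times> real) set" where
  "incoming = {g. \<forall>k. g k \<in> L1_mu {..<0}}"

definition outgoing :: "('d \<Rightarrow> real \<Rightarrow> real \<times> real) set" where
  "outgoing = {h. \<forall>k. h k \<in> L1_mu {0<..}}"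

text \<open>The finite type \<open>'d\<close> indexes the \<open>CARD('d) \<ge> 1\<close> pipes meeting at the junction.\<close>

definition mass_balance ::
  "('d::finite \<Rightarrow> real) \<Rightarrow> ('d \<Rightarrow> real \<Rightarrow> real \<times> real) \<Rightarrow> ('d \<Rightarrow> real \<Rightarrow> real \<times> real) \<Rightarrow> bool"
where
  "mass_balance A g h \<longleftrightarrow>
     (\<Sum>k\<in>UNIV. A k * ((LINT \<xi>|lebesgue_on {0<..}. \<xi> * fst (h k \<xi>))
                      + (LINT \<xi>|lebesgue_on {..<0}. \<xi> * fst (g k \<xi>)))) = 0"

text \<open>Only the part of the energy functional that depends on \<open>\<Psi>\<close>: the incoming part is fixed by
  \<open>g\<close> and may be \<open>-\<infinity>\<close>. The cast to \<^typ>\<open>ennreal\<close> loses nothing, because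
  \<^const>\<open>kinetic_energy\<close> is nonnegative on \<^const>\<open>state_space\<close> for \<open>1 < \<gamma> < 3\<close>, \<open>\<kappa> > 0\<close>.\<close>

definition outgoing_energy ::
  "real \<Rightarrow> real \<Rightarrow> ('d::finite \<Rightarrow> real) \<Rightarrow> ('d \<Rightarrow> real \<Rightarrow> real \<times> real) \<Rightarrow> ennreal" where
  "outgoing_energy \<kappa> \<gamma> A h =
     (\<Sum>k\<in>UNIV. ennreal (A k) *
        (\<integral>\<^sup>+ \<xi>. ennreal (\<xi> * kinetic_energy \<kappa> \<gamma> (h k \<xi>) \<xi>) \<partial>lebesgue_on {0<..}))"

definition mass_conserving_coupling ::
  "('d::finite \<Rightarrow> real) \<Rightarrow>
   (('d \<Rightarrow> real \<Rightarrow> real \<times> real) \<Rightarrow> ('d \<Rightarrow> real \<Rightarrow> real \<times> real)) \<Rightarrow> bool" where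
  "mass_conserving_coupling A \<Psi> \<longleftrightarrow>
     \<Psi> \<in> incoming \<rightarrow> outgoing \<and> (\<forall>g\<in>incoming. mass_balance A g (\<Psi> g))"

definition energy_minimizing_coupling ::
  "real \<Rightarrow> real \<Rightarrow> ('d::finite \<Rightarrow> real) \<Rightarrow>
   (('d \<Rightarrow> real \<Rightarrow> real \<times> real) \<Rightarrow> ('d \<Rightarrow> real \<Rightarrow> real \<times> real)) \<Rightarrow> bool" where
  "energy_minimizing_coupling \<kappa> \<gamma> A \<Psi> \<longleftrightarrow>
     mass_conserving_coupling A \<Psi> \<and>
     (\<forall>g\<in>incoming. \<forall>h\<in>outgoing. mass_balance A g h \<longrightarrow>
        outgoing_energy \<kappa> \<gamma> A (\<Psi> g) \<le> outgoing_energy \<kappa> \<gamma> A h)"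

definition is_rho_star ::
  "real \<Rightarrow> real \<Rightarrow> ('d::finite \<Rightarrow> real) \<Rightarrow> ('d \<Rightarrow> real \<Rightarrow> real \<times> real) \<Rightarrow> real \<Rightarrow> bool" where
  "is_rho_star \<kappa> \<gamma> A g \<rho> \<longleftrightarrow>
     \<rho> \<ge> 0 \<and> mass_balance A g (\<lambda>k. maxwellian \<kappa> \<gamma> \<rho> 0)"

definition rho_star ::
  "real \<Rightarrow> real \<Rightarrow> ('d::finite \<Rightarrow> real) \<Rightarrow> ('d \<Rightarrow> real \<Rightarrow> real \<times> real) \<Rightarrow> real" where
  "rho_star \<kappa> \<gamma> A g = (THE \<rho>. is_rho_star \<kappa> \<gamma> A g \<rho>)"

definition maxwellian_coupling ::
  "real \<Rightarrow> real \<Rightarrow> ('d::finite \<Rightarrow> real) \<Rightarrow>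
   ('d \<Rightarrow> real \<Rightarrow> real \<times> real) \<Rightarrow> ('d \<Rightarrow> real \<Rightarrow> real \<times> real)" where
  "maxwellian_coupling \<kappa> \<gamma> A g = (\<lambda>k. \<lambda>\<xi>\<in>{0<..}. maxwellian \<kappa> \<gamma> (rho_star \<kappa> \<gamma> A g) 0 \<xi>)"

end

(* Completing the square gives, with l = lam \<gamma> and p = 1 + 1/l,
     H(f, xi) = theta/2 (xi^2 f0 + f0^p / (p c^(1/l))) + (f1 - theta xi f0)^2 / (2 (1 - theta) f0).
   The first part is strictly convex in f0; at f0 = M0(rho, 0, xi) its slope is theta/2 max(R, xi^2)
   with R = a^2 rho^(\<gamma>-1), and f0 >= M0 = 0 where xi^2 > R. Hence
     H(f, xi) >= H(M, xi) + theta/2 R (f0 - M0), with equality only for f = M.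
   Multiplied by xi and integrated, the linear term vanishes by mass conservation.
   The outgoing mass flux of M is c R^(l+1) / (2 (l+1)), a bijection of rho >= 0 onto [0, oo). *)
theory Submission
  imports Defs
begin

section \<open>Real analysis: strict convexity of powers, compact supports, the normalising
  integral\<close>

text \<open>By the mean value theorem the chord slope between \<open>m\<close> and \<open>x\<close>
  equals \<open>p * z powr (p - 1)\<close> for some \<open>z\<close> strictly between them, and this
  derivative is strictly increasing. Differentiability is used at interior points only, so the
  vacuum values \<open>m = 0\<close> and \<open>x = 0\<close> are covered.\<close>

lemma powr_above_tangent:
  fixes p m x :: real
  assumes "p > 1" "m \<ge> 0" "x \<ge> 0" "x \<noteq> m"
  shows "x powr p > m powr p + p * m powr (p - 1) * (x - m)"
proof -
  have cont: "continuous_on {u..v} (\<lambda>z. z powr p)" if "u \<ge> 0" for u v :: real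
    using that assms(1) by (intro continuous_on_powr') (auto intro!: continuous_intros)
  have der: "((\<lambda>z. z powr p) has_derivative (\<lambda>h. (p * z powr (p - 1)) * h)) (at z)" if "z > 0" for z :: real
    using has_real_derivative_powr[OF that, of p] by (simp add: has_field_derivative_def)
  show ?thesis
  proof (cases "m < x")
    case True
    obtain z where z: "m < z" "z < x" "x powr p - m powr p = p * z powr (p - 1) * (x - m)"
      using mvt[OF True cont[OF assms(2)], of "\<lambda>z h. (p * z powr (p - 1)) * h"] der assms(2) by (metis le_less_trans)
    have "m powr (p - 1) < z powr (p - 1)"
      using z assms by (intro powr_less_mono2) auto
    then have "p * m powr (p - 1) * (x - m) < p * z powr (p - 1) * (x - m)"
      using assms True by simp
    then show ?thesis using z by simp
  next
    case False
    then have lt: "x < m" using assms by simp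
    obtain z where z: "x < z" "z < m" "m powr p - x powr p = p * z powr (p - 1) * (m - x)"
      using mvt[OF lt cont[OF assms(3)], of "\<lambda>z h. (p * z powr (p - 1)) * h"] der assms(3) by (metis le_less_trans)
    have "z powr (p - 1) < m powr (p - 1)"
      using z assms by (intro powr_less_mono2) auto
    then have "p * z powr (p - 1) * (m - x) < p * m powr (p - 1) * (m - x)"
      using assms lt by simp
    then show ?thesis using z by (simp add: algebra_simps)
  qed
qed

text \<open>Only the compact interval \<open>{0..s}\<close> contributes, and continuity suffices
  there. The general codomain serves both the pair-valued Maxwellian and real integrands.\<close>

lemma integrable_continuous_bounded_support:
  fixes f :: "real \<Rightarrow> 'a::euclidean_space"
  assumes "continuous_on UNIV f" "\<And>x. x > s \<Longrightarrow> f x = 0"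
  shows "integrable (lebesgue_on {0<..}) f"
proof -
  have "f absolutely_integrable_on {0..s}"
    using assms(1) by (intro absolutely_integrable_continuous_real continuous_on_subset[OF assms(1)]) auto
  then have "integrable lebesgue (\<lambda>x. indicator {0..s} x *\<^sub>R f x)"
    by (simp add: set_integrable_def)
  then have "integrable lebesgue (\<lambda>x. indicator {0<..} x *\<^sub>R (indicator {0..s} x *\<^sub>R f x))"
    by (rule integrable_mult_indicator[rotated]) simp
  moreover have "(\<lambda>x. indicator {0<..} x *\<^sub>R (indicator {0..s} x *\<^sub>R f x))
      = (\<lambda>x. indicator {0<..} x *\<^sub>R f x)"
  proof
    show "indicator {0<..} x *\<^sub>R (indicator {0..s} x *\<^sub>R f x) = indicator {0<..} x *\<^sub>R f x" for x
      using assms(2)[of x] by (cases "x > s") (auto simp: indicator_def)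
  qed
  ultimately show ?thesis
    by (simp add: integrable_restrict_space)
qed

lemma J_const_pos:
  assumes "l > 0"
  shows "J_const l > 0"
proof -
  let ?f = "\<lambda>z::real. (1 - z\<^sup>2) powr l"
  have le: "z\<^sup>2 \<le> 1" if "z \<in> {-1..1}" for z :: real
    using that by (simp add: abs_square_le_1 abs_le_iff)
  have cont: "continuous_on {-1..1} ?f"
    using le assms by (intro continuous_on_powr') (auto intro!: continuous_intros)
  have "integrable (lebesgue_on {-1..1}) ?f"
    using absolutely_integrable_continuous_real[OF cont]
    by (simp add: integrable_restrict_space set_integrable_def)
  then have "(?f has_integral J_const l) {-1..1}"
    unfolding J_const_def by (intro has_integral_integral_lebesgue_on) auto
  then have int: "(?f has_integral J_const l) (cbox (-1) 1)" by simp
  \<comment> \<open>A continuous nonnegative function with integral 0 vanishes on the whole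
    interval, but this one equals 1 at 0.\<close>
  have "J_const l \<noteq> 0"
  proof
    assume "J_const l = 0"
    then have "?f 0 = 0"
      using cont int by (intro has_integral_0_cbox_imp_0[where a = "-1" and b = 1 and f = ?f]) auto
    then show False by simp
  qed
  moreover have "J_const l \<ge> 0"
    unfolding J_const_def by (intro integral_nonneg_AE) auto
  ultimately show ?thesis by simp
qed

section \<open>Weighted integrability and mass fluxes\<close>

text \<open>A density changes neither the space nor the measurable sets, so measurability passes to
  \<open>lebesgue_on I\<close>; the weight then moves from the measure into the integrand.\<close>

lemma
  assumes "f \<in> L1_mu I" "I \<in> sets lebesgue"
  shows L1_mu_measurable: "f \<in> borel_measurable (lebesgue_on I)"
    and L1_mu_integrable: "integrable (lebesgue_on I) (\<lambda>\<xi>. \<bar>\<xi>\<bar> *\<^sub>R f \<xi>)"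
proof -
  have int: "integrable (density (lebesgue_on I) (\<lambda>\<xi>. ennreal \<bar>\<xi>\<bar>)) f"
    using assms by (simp add: L1_mu_def)
  from borel_measurable_integrable[OF this] show m: "f \<in> borel_measurable (lebesgue_on I)"
    by simp
  have "(\<lambda>\<xi>::real. \<bar>\<xi>\<bar>) \<in> borel_measurable (lebesgue_on I)"
    using assms(2) by (intro continuous_imp_measurable_on_sets_lebesgue continuous_intros)
  with int m show "integrable (lebesgue_on I) (\<lambda>\<xi>. \<bar>\<xi>\<bar> *\<^sub>R f \<xi>)"
    by (subst (asm) integrable_density) auto
qed

lemma L1_mu_state_space: "f \<in> L1_mu I \<Longrightarrow> \<xi> \<in> I \<Longrightarrow> f \<xi> \<in> state_space"
  by (auto simp: L1_mu_def)

lemma state_space_fst_nonneg: "f \<in> state_space \<Longrightarrow> fst f \<ge> 0"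
  by (auto simp: state_space_def)

lemma L1_mu_integrable_fst:
  assumes "f \<in> L1_mu {0<..}"
  shows "integrable (lebesgue_on {0<..}) (\<lambda>\<xi>. \<xi> * fst (f \<xi>))"
proof -
  have "integrable (lebesgue_on {0<..}) (\<lambda>\<xi>. fst (\<bar>\<xi>\<bar> *\<^sub>R f \<xi>))"
    by (rule integrable_bounded_linear[OF bounded_linear_fst L1_mu_integrable[OF assms]]) simp
  then show ?thesis
    by (rule Bochner_Integration.integrable_cong[THEN iffD1, rotated -1]) auto
qed

lemma outgoing_L1_mu: "h \<in> outgoing \<Longrightarrow> h k \<in> L1_mu {0<..}"
  by (simp add: outgoing_def)

text \<open>Ensures that the mass to be emitted is nonnegative, hence attainable as the flux of a
  Maxwellian.\<close>

lemma incoming_flux_nonpos: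
  assumes "g \<in> incoming"
  shows "(LINT \<xi>|lebesgue_on {..<0}. \<xi> * fst (g k \<xi>)) \<le> 0"
proof -
  have "0 \<le> (LINT \<xi>|lebesgue_on {..<0}. - (\<xi> * fst (g k \<xi>)))"
    using assms
    by (intro integral_nonneg_AE AE_I2)
       (auto simp: incoming_def mult_le_0_iff intro!: state_space_fst_nonneg L1_mu_state_space)
  then show ?thesis by simp
qed

section \<open>Constants of the gas and the Maxwellian with its support\<close>

locale polytropic_gas =
  fixes \<kappa> \<gamma> :: real
  assumes kappa_pos: "\<kappa> > 0" and gamma_gt_1: "1 < \<gamma>" and gamma_lt_3: "\<gamma> < 3"
begin

abbreviation "\<theta> \<equiv> theta \<gamma>"
abbreviation "\<Lambda> \<equiv> lam \<gamma>"
abbreviation "c \<equiv> c_const \<kappa> \<gamma>"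
abbreviation "a \<equiv> a_const \<kappa> \<gamma>"
abbreviation "H \<equiv> kinetic_energy \<kappa> \<gamma>"
abbreviation "M \<equiv> (\<lambda>\<rho>. maxwellian \<kappa> \<gamma> \<rho> 0)"

text \<open>The squared radius of the support of the Maxwellian; up to the factor \<open>\<theta> / 2\<close> it is the
  Lagrange multiplier of the mass constraint.\<close>

definition R :: "real \<Rightarrow> real" where
  "R \<rho> = a\<^sup>2 * \<rho> powr (\<gamma> - 1)"

text \<open>The slack in the tangent inequality for the energy. Its sign yields minimality, and its
  vanishing only at the Maxwellian yields uniqueness.\<close>

definition gap :: "real \<Rightarrow> real \<times> real \<Rightarrow> real \<Rightarrow> real" where
  "gap \<rho> f \<xi> = H f \<xi> - H (M \<rho> \<xi>) \<xi> - \<theta> / 2 * R \<rho> * (fst f - fst (M \<rho> \<xi>))"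

lemma theta_pos: "0 < \<theta>" and theta_lt_1: "\<theta> < 1"
  using gamma_gt_1 gamma_lt_3 by (auto simp: theta_def)

lemma lam_pos: "0 < \<Lambda>"
  using gamma_gt_1 gamma_lt_3 by (simp add: lam_def field_simps)

lemma a_pos: "0 < a"
  using kappa_pos gamma_gt_1 by (simp add: a_const_def)

lemma c_pos: "0 < c"
  using a_pos J_const_pos[OF lam_pos] by (simp add: c_const_def)

lemma R_nonneg: "0 \<le> R \<rho>"
  by (simp add: R_def)

lemma chi_eq: "chi \<kappa> \<gamma> \<rho> \<xi> = c * max 0 (R \<rho> - \<xi>\<^sup>2) powr \<Lambda>"
  by (simp add: chi_def R_def)

lemma maxwellian_eq: "M \<rho> \<xi> = (chi \<kappa> \<gamma> \<rho> \<xi>, \<theta> * \<xi> * chi \<kappa> \<gamma> \<rho> \<xi>)"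
  by (simp add: maxwellian_def)

lemma fst_maxwellian: "fst (M \<rho> \<xi>) = c * max 0 (R \<rho> - \<xi>\<^sup>2) powr \<Lambda>"
  by (simp add: maxwellian_eq chi_eq)

lemma chi_nonneg: "0 \<le> chi \<kappa> \<gamma> \<rho> \<xi>"
  using c_pos by (simp add: chi_eq)

lemma maxwellian_state_space: "M \<rho> \<xi> \<in> state_space"
  using chi_nonneg[of \<rho> \<xi>] by (auto simp: maxwellian_eq state_space_def)

text \<open>Since \<open>\<Lambda> > 0\<close>, the power is continuous down to base 0, hence across
  the edge of the support.\<close>

lemma continuous_chi: "continuous_on UNIV (chi \<kappa> \<gamma> \<rho>)"
  unfolding chi_eq[abs_def] using lam_pos
  by (intro continuous_intros continuous_on_powr') auto

lemma chi_outside_support: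
  assumes "\<xi> > sqrt (R \<rho>)"
  shows "chi \<kappa> \<gamma> \<rho> \<xi> = 0"
proof -
  have "R \<rho> \<le> \<xi>\<^sup>2"
    using assms by (meson less_eq_real_def real_less_rsqrt real_sqrt_le_iff sqrt_le_D)
  then show ?thesis by (simp add: chi_eq max_def)
qed

section \<open>The pointwise energy inequality\<close>

text \<open>What remains of \<open>H\<close> when the second component takes its optimal value
  \<open>\<theta> * \<xi> * r\<close>.\<close>

definition internal_energy :: "real \<Rightarrow> real \<Rightarrow> real" where
  "internal_energy r \<xi> =
     \<theta> / 2 * (\<xi>\<^sup>2 * r + r powr (1 + 1 / \<Lambda>) / ((1 + 1 / \<Lambda>) * c powr (1 / \<Lambda>)))"

lemma kinetic_energy_eq:
  assumes "f \<in> state_space"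
  shows "H f \<xi> = internal_energy (fst f) \<xi> + (snd f - \<theta> * \<xi> * fst f)\<^sup>2 / (2 * (1 - \<theta>) * fst f)"
proof (cases "f = (0, 0)")
  case True
  \<comment> \<open>At vacuum the quotient is 0 as well, because division by 0 gives 0.\<close>
  then show ?thesis by (simp add: kinetic_energy_def internal_energy_def)
next
  case False
  then have pos: "fst f > 0" using assms by (auto simp: state_space_def)
  \<comment> \<open>With \<open>\<theta>\<close> rewritten as \<open>1 - t\<close>, the denominators
    become products of \<open>t\<close> and \<open>r\<close>, both known to be positive.\<close>
  define r s t where "r = fst f" and "s = snd f" and "t = 1 - \<theta>"
  have t: "t > 0" "\<theta> = 1 - t" using theta_lt_1 by (auto simp: t_def)
  have "\<theta> / (1 - \<theta>) * (\<xi>\<^sup>2 / 2) * r + 1 / (1 - \<theta>) * (1 / 2) * (s\<^sup>2 / r) - \<theta> / (1 - \<theta>) * \<xi> * s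
      = \<theta> / 2 * (\<xi>\<^sup>2 * r) + (s - \<theta> * \<xi> * r)\<^sup>2 / (2 * (1 - \<theta>) * r)"
    using pos t unfolding t(2) r_def[symmetric]
    by (simp add: field_simps power2_eq_square)
  moreover have "\<theta> / (2 * c powr (1 / \<Lambda>)) * (r powr (1 + 1 / \<Lambda>) / (1 + 1 / \<Lambda>))
      = \<theta> / 2 * (r powr (1 + 1 / \<Lambda>) / ((1 + 1 / \<Lambda>) * c powr (1 / \<Lambda>)))"
    by simp
  ultimately show ?thesis
    using False by (simp add: kinetic_energy_def internal_energy_def r_def s_def ring_distribs)
qed

lemma internal_energy_above_tangent:
  assumes "r \<ge> 0" "r \<noteq> fst (M \<rho> \<xi>)"
  shows "internal_energy r \<xi> > internal_energy (fst (M \<rho> \<xi>)) \<xi> + \<theta> / 2 * R \<rho> * (r - fst (M \<rho> \<xi>))"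
proof -
  let ?m = "fst (M \<rho> \<xi>)" and ?p = "1 + 1 / \<Lambda>" and ?w = "max 0 (R \<rho> - \<xi>\<^sup>2)"
  let ?C = "?p * c powr (1 / \<Lambda>)"
  have m: "?m \<ge> 0" using c_pos by (simp add: fst_maxwellian)
  have p: "?p > 1" using lam_pos by simp
  have C: "?C > 0" using c_pos lam_pos by (auto intro!: mult_pos_pos add_pos_pos)
  \<comment> \<open>The exponent \<open>1 / \<Lambda>\<close> undoes the power in
    \<open>chi\<close>. So the slope at \<open>?m\<close> is
    \<open>\<theta> / 2 * (\<xi>\<^sup>2 + ?w)\<close>, that is, with
    \<open>max (R \<rho>) (\<xi>\<^sup>2)\<close> in the bracket.\<close>
  have "?m powr (?p - 1) = c powr (1 / \<Lambda>) * ?w"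
    using lam_pos c_pos by (simp add: fst_maxwellian powr_mult powr_powr)
  with powr_above_tangent[OF p m assms] have "r powr ?p > ?m powr ?p + ?C * (?w * (r - ?m))"
    by (simp add: mult_ac)
  then have "(?m powr ?p + ?C * (?w * (r - ?m))) / ?C < r powr ?p / ?C"
    using C by (rule divide_strict_right_mono)
  then have "?m powr ?p / ?C + ?w * (r - ?m) < r powr ?p / ?C"
    by (simp only: add_divide_distrib nonzero_mult_div_cancel_left[OF less_imp_neq[OF C, symmetric]])
  \<comment> \<open>Lowers the slope to the constant \<open>R \<rho>\<close>. Inside the support
    both agree; outside it \<open>?m = 0\<close>, so \<open>r - ?m\<close> is nonnegative.\<close>
  moreover have "R \<rho> * (r - ?m) \<le> (\<xi>\<^sup>2 + ?w) * (r - ?m)"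
  proof (cases "R \<rho> \<le> \<xi>\<^sup>2")
    case True
    then have "?m = 0" by (simp add: fst_maxwellian max_def)
    then show ?thesis using True assms(1) by (intro mult_right_mono) auto
  qed (simp add: max_def)
  ultimately have "R \<rho> * (r - ?m) < \<xi>\<^sup>2 * (r - ?m) + (r powr ?p / ?C - ?m powr ?p / ?C)"
    by (simp add: ring_distribs)
  then have "\<theta> / 2 * (R \<rho> * (r - ?m)) < \<theta> / 2 * (\<xi>\<^sup>2 * (r - ?m) + (r powr ?p / ?C - ?m powr ?p / ?C))"
    using theta_pos by (intro mult_strict_left_mono) auto
  \<comment> \<open>Hides the power term, so that the remaining arithmetic is polynomial.\<close>
  moreover define P where "P s = s powr ?p / ?C" for s
  then have "internal_energy s \<xi> = \<theta> / 2 * (\<xi>\<^sup>2 * s + P s)" for s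
    by (simp add: internal_energy_def)
  ultimately show ?thesis unfolding P_def[symmetric] by (simp add: algebra_simps diff_divide_distrib)
qed

lemma kinetic_energy_maxwellian: "H (M \<rho> \<xi>) \<xi> = internal_energy (chi \<kappa> \<gamma> \<rho> \<xi>) \<xi>"
  by (simp add: kinetic_energy_eq[OF maxwellian_state_space]) (simp add: maxwellian_eq)

text \<open>Strictness has two sources: strict convexity if the first components differ, and the
  square if only the second ones do.\<close>

lemma gap_pos:
  assumes "f \<in> state_space" "f \<noteq> M \<rho> \<xi>"
  shows "gap \<rho> f \<xi> > 0"
proof -
  let ?q = "(snd f - \<theta> * \<xi> * fst f)\<^sup>2 / (2 * (1 - \<theta>) * fst f)"
  have gap: "gap \<rho> f \<xi> = internal_energy (fst f) \<xi> - internal_energy (fst (M \<rho> \<xi>)) \<xi>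
      - \<theta> / 2 * R \<rho> * (fst f - fst (M \<rho> \<xi>)) + ?q"
    unfolding gap_def kinetic_energy_eq[OF assms(1)] kinetic_energy_maxwellian
    by (simp add: maxwellian_eq)
  have q: "?q \<ge> 0"
    using theta_lt_1 state_space_fst_nonneg[OF assms(1)] by simp
  show ?thesis
  proof (cases "fst f = fst (M \<rho> \<xi>)")
    case True
    then have ne: "snd f \<noteq> \<theta> * \<xi> * fst f"
      using assms(2) by (auto simp: maxwellian_eq prod_eq_iff)
    \<comment> \<open>Vacuum is excluded, since there both sides of \<open>ne\<close> would be 0.
      The square is thus divided by a positive number.\<close>
    then have "fst f > 0" using assms(1) by (auto simp: state_space_def)
    with ne have "?q > 0" using theta_lt_1 by (simp add: zero_less_mult_iff)
    with gap True show ?thesis by simp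
  next
    case False
    from internal_energy_above_tangent[OF state_space_fst_nonneg[OF assms(1)] False] q gap
    show ?thesis by simp
  qed
qed

lemma gap_maxwellian: "gap \<rho> (M \<rho> \<xi>) \<xi> = 0"
  by (simp add: gap_def)

lemma gap_nonneg: "f \<in> state_space \<Longrightarrow> gap \<rho> f \<xi> \<ge> 0"
  using gap_pos gap_maxwellian less_eq_real_def by metis

lemma internal_energy_nonneg: "r \<ge> 0 \<Longrightarrow> internal_energy r \<xi> \<ge> 0"
  using theta_pos c_pos lam_pos by (simp add: internal_energy_def)

lemma kinetic_energy_nonneg: "f \<in> state_space \<Longrightarrow> H f \<xi> \<ge> 0"
  using theta_lt_1 state_space_fst_nonneg internal_energy_nonneg by (simp add: kinetic_energy_eq)

section \<open>The Maxwellian as outgoing datum and its mass flux\<close>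

text \<open>Integrability comes from continuity and bounded support; the restriction is there
  because members of \<open>L1_mu\<close> are extensional.\<close>

lemma restrict_maxwellian_L1_mu: "restrict (M \<rho>) {0<..} \<in> L1_mu {0<..}"
proof -
  have cont: "continuous_on UNIV (M \<rho>)"
    unfolding maxwellian_eq[abs_def] by (intro continuous_intros continuous_chi)
  have meas: "M \<rho> \<in> borel_measurable (lebesgue_on {0<..})"
    by (intro continuous_imp_measurable_on_sets_lebesgue continuous_on_subset[OF cont]) auto
  have abs: "(\<lambda>\<xi>::real. \<bar>\<xi>\<bar>) \<in> borel_measurable (lebesgue_on {0<..})"
    by (intro continuous_imp_measurable_on_sets_lebesgue continuous_intros) simp
  have "integrable (lebesgue_on {0<..}) (\<lambda>\<xi>. \<bar>\<xi>\<bar> *\<^sub>R M \<rho> \<xi>)"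
    by (rule integrable_continuous_bounded_support[where s = "sqrt (R \<rho>)"])
       (auto intro!: continuous_intros continuous_chi simp: maxwellian_eq chi_outside_support zero_prod_def)
  then have "integrable (density (lebesgue_on {0<..}) (\<lambda>\<xi>. ennreal \<bar>\<xi>\<bar>)) (M \<rho>)"
    using meas abs by (subst integrable_density) auto
  then have "integrable (density (lebesgue_on {0<..}) (\<lambda>\<xi>. ennreal \<bar>\<xi>\<bar>)) (restrict (M \<rho>) {0<..})"
    by (rule Bochner_Integration.integrable_cong[THEN iffD1, rotated -1]) auto
  then show ?thesis
    using maxwellian_state_space by (auto simp: L1_mu_def)
qed

text \<open>The factor \<open>\<xi>\<close> makes the integrand an exact derivative:
  \<open>?F\<close> is an antiderivative up to the edge \<open>?s\<close> of the support.\<close>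

lemma maxwellian_flux:
  "(LINT \<xi>|lebesgue_on {0<..}. \<xi> * fst (M \<rho> \<xi>)) = c / (2 * (\<Lambda> + 1)) * R \<rho> powr (\<Lambda> + 1)"
proof -
  let ?f = "\<lambda>\<xi>. \<xi> * fst (M \<rho> \<xi>)" and ?s = "sqrt (R \<rho>)"
  let ?F = "\<lambda>\<xi>. - (c / (2 * (\<Lambda> + 1)) * (R \<rho> - \<xi>\<^sup>2) powr (\<Lambda> + 1))"
  have le: "\<xi>\<^sup>2 \<le> R \<rho>" if "\<xi> \<in> {0..?s}" for \<xi>
    using that R_nonneg[of \<rho>] by (metis atLeastAtMost_iff power_mono real_sqrt_pow2)
  have "(?f has_integral (?F ?s - ?F 0)) {0..?s}"
  \<comment> \<open>At \<open>?s\<close> the base \<open>R \<rho> - \<xi>\<^sup>2\<close> is 0 and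
    the derivative rule for \<open>powr\<close> does not apply; continuity is enough at the
    endpoints.\<close>
  proof (rule fundamental_theorem_of_calculus_interior)
    show "continuous_on {0..?s} ?F"
      using le lam_pos by (intro continuous_intros continuous_on_powr') auto
    fix \<xi> assume "\<xi> \<in> {0<..<?s}"
    then have lt: "\<xi>\<^sup>2 < R \<rho>"
      by (metis abs_of_pos greaterThanLessThan_iff real_less_rsqrt real_sqrt_abs real_sqrt_less_iff)
    have "(?F has_real_derivative - (c / (2 * (\<Lambda> + 1)) * ((\<Lambda> + 1) * (R \<rho> - \<xi>\<^sup>2) powr \<Lambda> * (- (2 * \<xi>))))) (at \<xi>)"
    proof (intro DERIV_minus DERIV_cmult)
      have "((\<lambda>\<xi>. R \<rho> - \<xi>\<^sup>2) has_real_derivative - (2 * \<xi>)) (at \<xi>)"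
        by (auto intro!: derivative_eq_intros)
      from DERIV_fun_powr[OF this, of "\<Lambda> + 1"] lt
      show "((\<lambda>\<xi>. (R \<rho> - \<xi>\<^sup>2) powr (\<Lambda> + 1)) has_real_derivative
          (\<Lambda> + 1) * (R \<rho> - \<xi>\<^sup>2) powr \<Lambda> * - (2 * \<xi>)) (at \<xi>)"
        by simp
    qed
    moreover have "- (c / (2 * (\<Lambda> + 1)) * ((\<Lambda> + 1) * (R \<rho> - \<xi>\<^sup>2) powr \<Lambda> * (- (2 * \<xi>)))) = ?f \<xi>"
    proof -
      have ne: "2 * \<Lambda> + 2 \<noteq> 0" using lam_pos by simp
      have "K * ((\<Lambda> + 1) * P * (2 * \<xi>)) / (2 * \<Lambda> + 2) = \<xi> * (K * P)" for K P
        unfolding nonzero_divide_eq_eq[OF ne] by (simp add: algebra_simps)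
      then show ?thesis
        using lt lam_pos by (simp add: fst_maxwellian max_def)
    qed
    ultimately show "(?F has_vector_derivative ?f \<xi>) (at \<xi>)"
      by (simp add: has_real_derivative_iff_has_vector_derivative)
  qed (use R_nonneg in auto)
  then have *: "(?f has_integral (c / (2 * (\<Lambda> + 1)) * R \<rho> powr (\<Lambda> + 1))) {0..?s}"
    using R_nonneg[of \<rho>] lam_pos by simp
  \<comment> \<open>The two domains differ by the null set \<open>{0}\<close> and by points beyond
    \<open>?s\<close>, where the integrand vanishes.\<close>
  have "(?f has_integral (c / (2 * (\<Lambda> + 1)) * R \<rho> powr (\<Lambda> + 1))) {0<..}"
    by (rule has_integral_spike_set_eq[THEN iffD1, OF _ _ *])
       (auto intro: negligible_subset[of "{0}"] simp: maxwellian_eq chi_outside_support not_le)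
  moreover have "integrable (lebesgue_on {0<..}) ?f"
    by (rule integrable_continuous_bounded_support[where s = ?s])
       (auto intro!: continuous_intros continuous_chi simp: maxwellian_eq chi_outside_support)
  then have "(?f has_integral (LINT \<xi>|lebesgue_on {0<..}. ?f \<xi>)) {0<..}"
    by (rule has_integral_integral_lebesgue_on) simp
  ultimately show ?thesis by (metis has_integral_unique)
qed

text \<open>On \<open>\<rho> \<ge> 0\<close> the flux is a positive multiple of a positive power of
  \<open>\<rho>\<close>: the inverse power gives existence, strict monotonicity uniqueness.\<close>

lemma ex1_maxwellian_flux:
  assumes "m \<ge> 0"
  shows "\<exists>!\<rho>. \<rho> \<ge> 0 \<and> (LINT \<xi>|lebesgue_on {0<..}. \<xi> * fst (M \<rho> \<xi>)) = m"
proof -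
  let ?q = "(\<gamma> - 1) * (\<Lambda> + 1)" and ?K = "c / (2 * (\<Lambda> + 1)) * (a\<^sup>2) powr (\<Lambda> + 1)"
  have q: "?q > 0" using gamma_gt_1 lam_pos by simp
  have K: "?K > 0" using c_pos a_pos lam_pos by simp
  have flux: "(LINT \<xi>|lebesgue_on {0<..}. \<xi> * fst (M \<rho> \<xi>)) = ?K * \<rho> powr ?q" if "\<rho> \<ge> 0" for \<rho>
    using that by (simp add: maxwellian_flux R_def powr_mult powr_powr)
  show ?thesis
  proof (rule ex_ex1I)
    \<comment> \<open>Stated for arbitrary \<open>K\<close> and \<open>q\<close> to keep the
      simplifier from expanding the actual constants.\<close>
    have "K * ((m / K) powr (1 / q)) powr q = m" if "K > 0" "q > 0" for K q :: real
      using that assms by (simp add: powr_powr)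
    note this[OF K q]
    then have "(LINT \<xi>|lebesgue_on {0<..}. \<xi> * fst (M ((m / ?K) powr (1 / ?q)) \<xi>)) = m"
      unfolding flux[OF powr_ge_zero] .
    then show "\<exists>\<rho>\<ge>0. (LINT \<xi>|lebesgue_on {0<..}. \<xi> * fst (M \<rho> \<xi>)) = m"
      by (intro exI[of _ "(m / ?K) powr (1 / ?q)"] conjI powr_ge_zero)
  next
    fix \<rho> \<sigma>
    assume "\<rho> \<ge> 0 \<and> (LINT \<xi>|lebesgue_on {0<..}. \<xi> * fst (M \<rho> \<xi>)) = m"
      and "\<sigma> \<ge> 0 \<and> (LINT \<xi>|lebesgue_on {0<..}. \<xi> * fst (M \<sigma> \<xi>)) = m"
    then have nn: "\<rho> \<ge> 0" "\<sigma> \<ge> 0" and "?K * \<rho> powr ?q = ?K * \<sigma> powr ?q"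
      using flux by auto
    then have eq: "\<rho> powr ?q = \<sigma> powr ?q"
      by (simp only: mult_left_cancel[OF less_imp_neq[OF K, symmetric]])
    show "\<rho> = \<sigma>"
    proof (rule linorder_cases)
      assume "\<rho> < \<sigma>"
      from powr_less_mono2[OF q nn(1) this] eq show ?thesis by simp
    next
      assume "\<sigma> < \<rho>"
      from powr_less_mono2[OF q nn(2) this] eq show ?thesis by simp
    qed
  qed
qed

section \<open>The energy balance of a single pipe\<close>

text \<open>Needed for uniqueness: only a finite energy can be cancelled in
  \<open>ennreal\<close>.\<close>

lemma maxwellian_energy_finite:
  "(\<integral>\<^sup>+ \<xi>. ennreal (\<xi> * H (M \<rho> \<xi>) \<xi>) \<partial>lebesgue_on {0<..}) < \<infinity>"
proof -
  let ?C = "(1 + 1 / \<Lambda>) * c powr (1 / \<Lambda>)"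
  have p: "1 + 1 / \<Lambda> > 0" using lam_pos by (simp add: add_pos_pos)
  have C: "?C \<noteq> 0" using p c_pos by simp
  have "continuous_on UNIV (\<lambda>\<xi>. chi \<kappa> \<gamma> \<rho> \<xi> powr (1 + 1 / \<Lambda>))"
    using p chi_nonneg by (intro continuous_on_powr' continuous_chi continuous_on_const) blast
  then have "continuous_on UNIV (\<lambda>\<xi>. \<xi> * (\<theta> / 2 * (\<xi>\<^sup>2 * chi \<kappa> \<gamma> \<rho> \<xi> + chi \<kappa> \<gamma> \<rho> \<xi> powr (1 + 1 / \<Lambda>) / ?C)))"
    using C by (intro continuous_on_mult continuous_on_add continuous_on_divide continuous_on_power
        continuous_on_const continuous_on_id continuous_chi) auto
  then have cont: "continuous_on UNIV (\<lambda>\<xi>. \<xi> * H (M \<rho> \<xi>) \<xi>)"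
    by (simp only: kinetic_energy_maxwellian internal_energy_def)
  have "integrable (lebesgue_on {0<..}) (\<lambda>\<xi>. \<xi> * H (M \<rho> \<xi>) \<xi>)"
    using cont
    by (rule integrable_continuous_bounded_support[where s = "sqrt (R \<rho>)"])
       (simp add: kinetic_energy_maxwellian chi_outside_support internal_energy_def)
  then have "(\<integral>\<^sup>+ \<xi>. ennreal (\<xi> * H (M \<rho> \<xi>) \<xi>) \<partial>lebesgue_on {0<..})
      = ennreal (LINT \<xi>|lebesgue_on {0<..}. \<xi> * H (M \<rho> \<xi>) \<xi>)"
    by (intro nn_integral_eq_integral AE_I2 mult_nonneg_nonneg kinetic_energy_nonneg maxwellian_state_space)
       auto
  then show ?thesis by simp
qed

text \<open>The completed square has no case distinction at vacuum, so its measurability follows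
  from that of the components.\<close>

lemma kinetic_energy_measurable:
  assumes "f \<in> L1_mu {0<..}"
  shows "(\<lambda>\<xi>. H (f \<xi>) \<xi>) \<in> borel_measurable (lebesgue_on {0<..})"
proof -
  have [measurable]: "(\<lambda>\<xi>. fst (f \<xi>)) \<in> borel_measurable (lebesgue_on {0<..})"
    by (rule measurable_compose[OF L1_mu_measurable[OF assms] borel_measurable_continuous_onI])
       (auto intro: continuous_intros)
  have [measurable]: "(\<lambda>\<xi>. snd (f \<xi>)) \<in> borel_measurable (lebesgue_on {0<..})"
    by (rule measurable_compose[OF L1_mu_measurable[OF assms] borel_measurable_continuous_onI])
       (auto intro: continuous_intros)
  have [measurable]: "(\<lambda>\<xi>::real. \<xi>) \<in> borel_measurable (lebesgue_on {0<..})"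
    by (intro continuous_imp_measurable_on_sets_lebesgue continuous_intros) simp
  have "(\<lambda>\<xi>. internal_energy (fst (f \<xi>)) \<xi>
      + (snd (f \<xi>) - \<theta> * \<xi> * fst (f \<xi>))\<^sup>2 / (2 * (1 - \<theta>) * fst (f \<xi>))) \<in> borel_measurable (lebesgue_on {0<..})"
    unfolding internal_energy_def by measurable
  then show ?thesis
    by (rule measurable_cong[THEN iffD1, rotated])
       (simp add: kinetic_energy_eq L1_mu_state_space[OF assms])
qed

text \<open>The integrated definition of \<open>gap\<close>, with negative terms moved across so
  that every integrand is nonnegative. This form needs no subtraction and holds even if the energy
  of \<open>f\<close> is infinite.\<close>

lemma
  assumes "f \<in> L1_mu {0<..}"
  shows gap_measurable: "(\<lambda>\<xi>. \<xi> * gap \<rho> (f \<xi>) \<xi>) \<in> borel_measurable (lebesgue_on {0<..})" (is ?meas)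
    and nn_integral_kinetic_energy:
      "(\<integral>\<^sup>+ \<xi>. ennreal (\<xi> * H (f \<xi>) \<xi>) \<partial>lebesgue_on {0<..})
        + ennreal (\<theta> / 2 * R \<rho> * (LINT \<xi>|lebesgue_on {0<..}. \<xi> * fst (M \<rho> \<xi>)))
       = (\<integral>\<^sup>+ \<xi>. ennreal (\<xi> * H (M \<rho> \<xi>) \<xi>) \<partial>lebesgue_on {0<..})
        + (\<integral>\<^sup>+ \<xi>. ennreal (\<xi> * gap \<rho> (f \<xi>) \<xi>) \<partial>lebesgue_on {0<..})
        + ennreal (\<theta> / 2 * R \<rho> * (LINT \<xi>|lebesgue_on {0<..}. \<xi> * fst (f \<xi>)))" (is ?energy)
proof -
  let ?L = "lebesgue_on {0<..} :: real measure" and ?C = "\<theta> / 2 * R \<rho>"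
  have C: "?C \<ge> 0" using theta_pos R_nonneg by simp
  let ?M = "restrict (M \<rho>) {0<..}"
  have if1: "integrable ?L (\<lambda>\<xi>. ?C * (\<xi> * fst (f \<xi>)))"
    using L1_mu_integrable_fst[OF assms] by simp
  have im1: "integrable ?L (\<lambda>\<xi>. ?C * (\<xi> * fst (M \<rho> \<xi>)))"
    using integrable_mult_right[OF L1_mu_integrable_fst[OF restrict_maxwellian_L1_mu[of \<rho>]], of ?C]
    by (rule Bochner_Integration.integrable_cong[THEN iffD1, rotated -1]) auto
  have id: "(\<lambda>\<xi>::real. \<xi>) \<in> borel_measurable ?L"
    by (intro continuous_imp_measurable_on_sets_lebesgue continuous_intros) simp
  have [measurable]: "(\<lambda>\<xi>. \<xi> * H (f \<xi>) \<xi>) \<in> borel_measurable ?L"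
    by (rule borel_measurable_times[OF id kinetic_energy_measurable[OF assms]])
  have "(\<lambda>\<xi>. \<xi> * H (?M \<xi>) \<xi>) \<in> borel_measurable ?L"
    by (rule borel_measurable_times[OF id kinetic_energy_measurable[OF restrict_maxwellian_L1_mu]])
  then have [measurable]: "(\<lambda>\<xi>. \<xi> * H (M \<rho> \<xi>) \<xi>) \<in> borel_measurable ?L"
    by (rule measurable_cong[THEN iffD1, rotated]) auto
  note [measurable] = borel_measurable_integrable[OF if1] borel_measurable_integrable[OF im1]
  have split: "\<xi> * gap \<rho> (f \<xi>) \<xi> = \<xi> * H (f \<xi>) \<xi> - \<xi> * H (M \<rho> \<xi>) \<xi>
      - (?C * (\<xi> * fst (f \<xi>)) - ?C * (\<xi> * fst (M \<rho> \<xi>)))" for \<xi>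
  proof -
    have "\<xi> * (x - y - C * (u - v)) = \<xi> * x - \<xi> * y - (C * (\<xi> * u) - C * (\<xi> * v))" for x y u v C
      by (simp add: algebra_simps)
    then show ?thesis unfolding gap_def .
  qed
  show gap[measurable]: ?meas
    unfolding split by measurable
  have m: "(\<lambda>\<xi>. ennreal (\<xi> * H (f \<xi>) \<xi>)) \<in> borel_measurable ?L"
    "(\<lambda>\<xi>. ennreal (\<xi> * H (M \<rho> \<xi>) \<xi>)) \<in> borel_measurable ?L"
    "(\<lambda>\<xi>. ennreal (\<xi> * gap \<rho> (f \<xi>) \<xi>)) \<in> borel_measurable ?L"
    "(\<lambda>\<xi>. ennreal (?C * (\<xi> * fst (f \<xi>)))) \<in> borel_measurable ?L"
    "(\<lambda>\<xi>. ennreal (?C * (\<xi> * fst (M \<rho> \<xi>)))) \<in> borel_measurable ?L"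
    by (rule measurable_compose[OF _ measurable_ennreal], (fact | measurable))+
  \<comment> \<open>These signs allow sums of \<open>ennreal\<close> casts to be merged into the
    cast of a real sum, where \<open>split\<close> applies.\<close>
  have nn: "\<xi> * H (f \<xi>) \<xi> \<ge> 0" "\<xi> * H (M \<rho> \<xi>) \<xi> \<ge> 0" "\<xi> * gap \<rho> (f \<xi>) \<xi> \<ge> 0"
    "?C * (\<xi> * fst (f \<xi>)) \<ge> 0" "?C * (\<xi> * fst (M \<rho> \<xi>)) \<ge> 0" if "\<xi> \<in> space ?L" for \<xi>
    using that C L1_mu_state_space[OF assms, of \<xi>] maxwellian_state_space[of \<rho> \<xi>]
    by (auto intro!: mult_nonneg_nonneg kinetic_energy_nonneg gap_nonneg state_space_fst_nonneg
        simp del: times_divide_eq_left)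
  have "(\<integral>\<^sup>+ \<xi>. ennreal (\<xi> * H (f \<xi>) \<xi>) \<partial>?L) + (\<integral>\<^sup>+ \<xi>. ennreal (?C * (\<xi> * fst (M \<rho> \<xi>))) \<partial>?L)
      = (\<integral>\<^sup>+ \<xi>. ennreal (\<xi> * H (f \<xi>) \<xi>) + ennreal (?C * (\<xi> * fst (M \<rho> \<xi>))) \<partial>?L)"
    by (simp only: nn_integral_add m)
  also have "\<dots> = (\<integral>\<^sup>+ \<xi>. (ennreal (\<xi> * H (M \<rho> \<xi>) \<xi>) + ennreal (\<xi> * gap \<rho> (f \<xi>) \<xi>))
      + ennreal (?C * (\<xi> * fst (f \<xi>))) \<partial>?L)"
  proof (intro nn_integral_cong)
    fix \<xi> assume "\<xi> \<in> space ?L"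
    note nn = nn[OF this]
    show "ennreal (\<xi> * H (f \<xi>) \<xi>) + ennreal (?C * (\<xi> * fst (M \<rho> \<xi>)))
      = (ennreal (\<xi> * H (M \<rho> \<xi>) \<xi>) + ennreal (\<xi> * gap \<rho> (f \<xi>) \<xi>)) + ennreal (?C * (\<xi> * fst (f \<xi>)))"
      using nn by (simp only: ennreal_plus[symmetric] add_nonneg_nonneg) (simp add: split)
  qed
  also have "\<dots> = (\<integral>\<^sup>+ \<xi>. ennreal (\<xi> * H (M \<rho> \<xi>) \<xi>) \<partial>?L) + (\<integral>\<^sup>+ \<xi>. ennreal (\<xi> * gap \<rho> (f \<xi>) \<xi>) \<partial>?L)
      + (\<integral>\<^sup>+ \<xi>. ennreal (?C * (\<xi> * fst (f \<xi>))) \<partial>?L)"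
    by (simp only: nn_integral_add m borel_measurable_add)
  \<comment> \<open>The two linear terms are integrable, so their nonnegative integrals are casts of
    real ones.\<close>
  finally show ?energy
    using nn_integral_eq_integral[OF if1 AE_I2[OF nn(4)]] nn_integral_eq_integral[OF im1 AE_I2[OF nn(5)]]
    by simp
qed

lemma gap_nn_integral_eq_0:
  assumes "f \<in> L1_mu {0<..}" "(\<integral>\<^sup>+ \<xi>. ennreal (\<xi> * gap \<rho> (f \<xi>) \<xi>) \<partial>lebesgue_on {0<..}) = 0"
  shows "AE \<xi> in lebesgue_on {0<..}. f \<xi> = M \<rho> \<xi>"
proof -
  have "AE \<xi> in lebesgue_on {0<..}. ennreal (\<xi> * gap \<rho> (f \<xi>) \<xi>) = 0"
    using assms(2) gap_measurable[OF assms(1), of \<rho>] by (subst (asm) nn_integral_0_iff_AE) auto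
  then show ?thesis
  proof (rule AE_mp, intro AE_I2 impI)
    fix \<xi> assume "\<xi> \<in> space (lebesgue_on {0<..})" "ennreal (\<xi> * gap \<rho> (f \<xi>) \<xi>) = 0"
    then have "\<xi> > 0" "gap \<rho> (f \<xi>) \<xi> \<le> 0"
      by (auto simp: ennreal_eq_0_iff mult_le_0_iff)
    then show "f \<xi> = M \<rho> \<xi>"
      using gap_pos[OF L1_mu_state_space[OF assms(1)], of \<xi> \<rho>] by fastforce
  qed
qed

end

section \<open>The junction: coupling density, minimality and uniqueness\<close>

locale junction = polytropic_gas +
  fixes A :: "'d::finite \<Rightarrow> real"
  assumes A_pos: "\<And>k. A k > 0"
begin

abbreviation "energy \<equiv> outgoing_energy \<kappa> \<gamma> A"

text \<open>All pipes emit the same flux, so dividing the mass balance by the total area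
  \<open>?S\<close> leaves one equation for the flux of a single Maxwellian.\<close>

lemma ex1_rho_star:
  assumes "g \<in> incoming"
  shows "\<exists>!\<rho>. is_rho_star \<kappa> \<gamma> A g \<rho>"
proof -
  let ?S = "\<Sum>k\<in>UNIV. A k" and ?m = "\<Sum>k\<in>UNIV. A k * (LINT \<xi>|lebesgue_on {..<0}. \<xi> * fst (g k \<xi>))"
  have S: "?S > 0" using A_pos by (intro sum_pos) auto
  have "?m \<le> 0"
    using incoming_flux_nonpos[OF assms] A_pos
    by (intro sum_nonpos mult_nonneg_nonpos) (auto intro: less_imp_le)
  then have "- ?m / ?S \<ge> 0" using S by (intro divide_nonneg_pos) auto
  moreover have "is_rho_star \<kappa> \<gamma> A g \<rho> \<longleftrightarrow>
      \<rho> \<ge> 0 \<and> (LINT \<xi>|lebesgue_on {0<..}. \<xi> * fst (M \<rho> \<xi>)) = - ?m / ?S" for \<rho>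
    using S by (auto simp: is_rho_star_def mass_balance_def ring_distribs sum.distrib
        sum_distrib_right[symmetric] field_simps)
  ultimately show ?thesis using ex1_maxwellian_flux by presburger
qed

text \<open>The area-weighted sum of the pipewise balances. The multiplier is the same in every
  pipe, so the linear terms see only the total mass flux, on which \<open>h\<close> and the
  Maxwellian agree.\<close>

lemma outgoing_energy_split:
  assumes "is_rho_star \<kappa> \<gamma> A g \<rho>" "h \<in> outgoing" "mass_balance A g h"
  shows "energy h = energy (\<lambda>k. M \<rho>)
    + (\<Sum>k\<in>UNIV. ennreal (A k) * (\<integral>\<^sup>+ \<xi>. ennreal (\<xi> * gap \<rho> (h k \<xi>) \<xi>) \<partial>lebesgue_on {0<..}))"
    (is "_ = _ + ?gap")
proof -
  let ?L = "lebesgue_on {0<..} :: real measure"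
  define C where "C = \<theta> / 2 * R \<rho>"
  have C: "C \<ge> 0" using theta_pos R_nonneg by (simp add: C_def)
  let ?flux = "\<lambda>f. (LINT \<xi>|?L. \<xi> * fst (f \<xi>))"
  have flux_nonneg: "?flux f \<ge> 0" if "\<And>\<xi>. \<xi> > 0 \<Longrightarrow> f \<xi> \<in> state_space" for f
    using that by (intro integral_nonneg_AE AE_I2) (auto intro!: mult_nonneg_nonneg state_space_fst_nonneg)
  have sum_eq: "(\<Sum>k\<in>UNIV. ennreal (A k) * ennreal (C * ?flux (f k))) = ennreal (C * (\<Sum>k\<in>UNIV. A k * ?flux (f k)))"
    if "\<And>k \<xi>. \<xi> > 0 \<Longrightarrow> f k \<xi> \<in> state_space" for f :: "'d \<Rightarrow> real \<Rightarrow> real \<times> real"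
  proof -
    have "(\<Sum>k\<in>UNIV. ennreal (A k) * ennreal (C * ?flux (f k))) = (\<Sum>k\<in>UNIV. ennreal (A k * (C * ?flux (f k))))"
      using A_pos C flux_nonneg that
      by (intro sum.cong refl ennreal_mult[symmetric] mult_nonneg_nonneg) (auto intro: less_imp_le)
    also have "\<dots> = ennreal (\<Sum>k\<in>UNIV. A k * (C * ?flux (f k)))"
      using A_pos C flux_nonneg that
      by (intro sum_ennreal mult_nonneg_nonneg) (auto intro: less_imp_le)
    also have "(\<Sum>k\<in>UNIV. A k * (C * ?flux (f k))) = C * (\<Sum>k\<in>UNIV. A k * ?flux (f k))"
      by (simp add: sum_distrib_left mult_ac)
    finally show ?thesis .
  qed
  have mass: "(\<Sum>k\<in>UNIV. A k * ?flux (h k)) = (\<Sum>k\<in>UNIV. A k * ?flux (M \<rho>))"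
    using assms(1,3) unfolding is_rho_star_def mass_balance_def
    by (simp add: ring_distribs sum.distrib)
  \<comment> \<open>The common linear term. As the cast of a real it is finite and can be cancelled
    at the end.\<close>
  let ?X = "ennreal (C * (\<Sum>k\<in>UNIV. A k * ?flux (M \<rho>)))"
  have "?X + energy h = energy h + ?X" by (rule add.commute)
  also have "\<dots> = (\<Sum>k\<in>UNIV. ennreal (A k) *
      ((\<integral>\<^sup>+ \<xi>. ennreal (\<xi> * H (h k \<xi>) \<xi>) \<partial>?L) + ennreal (C * ?flux (M \<rho>))))"
    using sum_eq[of "\<lambda>k. M \<rho>"] maxwellian_state_space
    by (simp add: outgoing_energy_def ring_distribs sum.distrib)
  also have "\<dots> = energy (\<lambda>k. M \<rho>) + ?gap + (\<Sum>k\<in>UNIV. ennreal (A k) * ennreal (C * ?flux (h k)))"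
    unfolding nn_integral_kinetic_energy[OF outgoing_L1_mu[OF assms(2)], of _ \<rho>, folded C_def]
    by (simp only: outgoing_energy_def ring_distribs sum.distrib)
  also have "(\<Sum>k\<in>UNIV. ennreal (A k) * ennreal (C * ?flux (h k))) = ?X"
    using sum_eq[of h] L1_mu_state_space[OF outgoing_L1_mu[OF assms(2)]] mass by simp
  also have "energy (\<lambda>k. M \<rho>) + ?gap + ?X = ?X + (energy (\<lambda>k. M \<rho>) + ?gap)" by (rule add.commute)
  finally show ?thesis
    unfolding ennreal_add_left_cancel by simp
qed

lemma is_rho_star_rho_star: "g \<in> incoming \<Longrightarrow> is_rho_star \<kappa> \<gamma> A g (rho_star \<kappa> \<gamma> A g)"
  unfolding rho_star_def by (rule theI'[OF ex1_rho_star])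

lemma energy_maxwellian_coupling:
  "energy (maxwellian_coupling \<kappa> \<gamma> A g) = energy (\<lambda>k. M (rho_star \<kappa> \<gamma> A g))"
  unfolding outgoing_energy_def maxwellian_coupling_def
  by (intro sum.cong refl arg_cong2[where f = "(*)"] nn_integral_cong) simp

lemma mass_conserving_maxwellian_coupling: "mass_conserving_coupling A (maxwellian_coupling \<kappa> \<gamma> A)"
  unfolding mass_conserving_coupling_def
proof (intro conjI ballI funcsetI)
  fix g :: "'d \<Rightarrow> real \<Rightarrow> real \<times> real"
  show "maxwellian_coupling \<kappa> \<gamma> A g \<in> outgoing"
    by (simp add: outgoing_def maxwellian_coupling_def restrict_maxwellian_L1_mu)
  assume "g \<in> incoming"
  then have "mass_balance A g (\<lambda>k. M (rho_star \<kappa> \<gamma> A g))"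
    using is_rho_star_rho_star by (simp add: is_rho_star_def)
  moreover have "(LINT \<xi>|lebesgue_on {0<..}. \<xi> * fst (maxwellian_coupling \<kappa> \<gamma> A g k \<xi>))
      = (LINT \<xi>|lebesgue_on {0<..}. \<xi> * fst (M (rho_star \<kappa> \<gamma> A g) \<xi>))" for k
    by (rule Bochner_Integration.integral_cong) (auto simp: maxwellian_coupling_def)
  ultimately show "mass_balance A g (maxwellian_coupling \<kappa> \<gamma> A g)"
    by (simp add: mass_balance_def)
qed

text \<open>By the split, a competitor has the energy of the Maxwellian plus an element of
  \<open>ennreal\<close>.\<close>

lemma energy_minimizing_maxwellian_coupling:
  "energy_minimizing_coupling \<kappa> \<gamma> A (maxwellian_coupling \<kappa> \<gamma> A)"
  unfolding energy_minimizing_coupling_def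
  using mass_conserving_maxwellian_coupling outgoing_energy_split[OF is_rho_star_rho_star]
  by (simp add: energy_maxwellian_coupling)

text \<open>The Maxwellian coupling is itself admissible, so a minimizer has no more energy than it;
  the split then forces every weighted gap integral to be 0.\<close>

lemma energy_minimizing_coupling_unique:
  assumes "energy_minimizing_coupling \<kappa> \<gamma> A \<Psi>" "g \<in> incoming"
  shows "AE \<xi> in lebesgue_on {0<..}. \<Psi> g k \<xi> = maxwellian_coupling \<kappa> \<gamma> A g k \<xi>"
proof -
  let ?\<rho> = "rho_star \<kappa> \<gamma> A g"
  let ?G = "\<lambda>k. ennreal (A k) * (\<integral>\<^sup>+ \<xi>. ennreal (\<xi> * gap ?\<rho> (\<Psi> g k \<xi>) \<xi>) \<partial>lebesgue_on {0<..})"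
  have \<Psi>: "\<Psi> g \<in> outgoing" "mass_balance A g (\<Psi> g)"
    using assms by (auto simp: energy_minimizing_coupling_def mass_conserving_coupling_def)
  have "energy (\<Psi> g) \<le> energy (maxwellian_coupling \<kappa> \<gamma> A g)"
    using assms mass_conserving_maxwellian_coupling
    unfolding energy_minimizing_coupling_def mass_conserving_coupling_def by (blast dest: funcset_mem)
  \<comment> \<open>The summand 0 brings the bound into the shape of the cancellation rule.\<close>
  then have "energy (\<lambda>k. M ?\<rho>) + (\<Sum>k\<in>UNIV. ?G k) \<le> energy (\<lambda>k. M ?\<rho>) + 0"
    using outgoing_energy_split[OF is_rho_star_rho_star[OF assms(2)] \<Psi>]
    by (simp add: energy_maxwellian_coupling)
  moreover have "energy (\<lambda>k. M ?\<rho>) < \<infinity>"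
    using maxwellian_energy_finite[of ?\<rho>]
    by (auto simp: outgoing_energy_def ennreal_mult_less_top less_top)
  ultimately have "(\<Sum>k\<in>UNIV. ?G k) \<le> 0"
    by (subst (asm) ennreal_add_left_cancel_le) auto
  then have "?G k = 0" by simp
  then have "AE \<xi> in lebesgue_on {0<..}. \<Psi> g k \<xi> = M ?\<rho> \<xi>"
    using A_pos[of k] by (intro gap_nn_integral_eq_0 outgoing_L1_mu \<Psi>) (simp add: ennreal_eq_0_iff not_le)
  then show ?thesis
    by (rule AE_mp, intro AE_I2) (simp add: maxwellian_coupling_def)
qed

end

theorem theorem1:
  fixes \<kappa> \<gamma> :: real and A :: "'d::finite \<Rightarrow> real"
  assumes "\<kappa> > 0" and "1 < \<gamma>" and "\<gamma> < 3" and "\<And>k. A k > 0"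
  shows "(\<forall>g\<in>incoming. \<exists>!\<rho>. is_rho_star \<kappa> \<gamma> A g \<rho>) \<and>
    energy_minimizing_coupling \<kappa> \<gamma> A (maxwellian_coupling \<kappa> \<gamma> A) \<and>
    (\<forall>\<Psi>. energy_minimizing_coupling \<kappa> \<gamma> A \<Psi> \<longrightarrow>
       (\<forall>g\<in>incoming. \<forall>k. AE \<xi> in lebesgue_on {0<..}.
          \<Psi> g k \<xi> = maxwellian_coupling \<kappa> \<gamma> A g k \<xi>))"
proof -
  interpret junction \<kappa> \<gamma> A
    by standard (use assms in auto)
  show ?thesis
    using ex1_rho_star energy_minimizing_maxwellian_coupling energy_minimizing_coupling_unique by blast
qed

end
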